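(* Let $(A,\circ,[\cdot,\cdot])$ be a Gel'fand-Dorfman algebra and let $r\in A\otimes A$ be a skew-symmetric solution of the Gel'fand-Dorfman Yang-Baxter equation in $A$. Define $\Delta_r,\delta_r:A\to A\otimes A$ by $$\Delta_r(a)=-(L_\circ(a)\otimes\mathrm{id}+\mathrm{id}\otimes L_\star(a))r,\qquad \delta_r(a)=(\mathrm{ad}(a)\otimes\mathrm{id}+\mathrm{id}\otimes\mathrm{ad}(a))r,\qquad a\in A.$$ Then $(A,\circ,[\cdot,\cdot],\Delta_r,\delta_r)$ is a Gel'fand-Dorfman bialgebra.
   Context: Conventions: $\mathbf{k}$ is a field of characteristic $0$; vector spaces over $\mathbf{k}$ are finite-dimensional; $\otimes=\otimes_{\mathbf{k}}$; $\tau(a\otimes b)=b\otimes a$. For a binary operation $\circ$: $L_\circ(a)b=a\circ b$, $R_\circ(a)b=b\circ a$, $a\star b=a\circ b+b\circ a$, $L_\star(a)b=a\star b$. For a Lie bracket, $\mathrm{ad}(a)b=[a,b]$ and $a.(b\otimes c)=[a,b]\otimes c+b\otimes[a,c]$. An element $r\in A\otimes A$ is skew-symmetric if $r+\tau r=0$. A Novikov algebra $(A,\circ)$ satisfies $(a\circ b)\circ c-a\circ(b\circ c)=(b\circ a)\circ c-b\circ(a\circ c)$ and $(a\circ b)\circ c=(a\circ c)\circ b$. A Gel'fand-Dorfman (GD) algebra $(A,\circ,[\cdot,\cdot])$ is a Novikov algebra $(A,\circ)$ and a Lie algebra $(A,[\cdot,\cdot])$ with $[a\circ b,c]-[a\circ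 c,b]+[a,b]\circ c-[a,c]\circ b-a\circ[b,c]=0$ for all $a,b,c$. The Gel'fand-Dorfman Yang-Baxter equation (GDYBE) in $A$ for $r=\sum_\alpha x_\alpha\otimes y_\alpha$ is $\mathbf{N}(r)=\mathbf{C}(r)=0$ in $A\otimes A\otimes A$, where $\mathbf{N}(r)=\sum_{\alpha,\beta}\big(x_\alpha\otimes x_\beta\otimes y_\alpha\circ y_\beta+x_\alpha\otimes y_\alpha\star x_\beta\otimes y_\beta+x_\alpha\circ x_\beta\otimes y_\beta\otimes y_\alpha\big)$, $\mathbf{C}(r)=\sum_{\alpha,\beta}\big([x_\alpha,x_\beta]\otimes y_\alpha\otimes y_\beta+x_\alpha\otimes[y_\alpha,x_\beta]\otimes y_\beta+x_\alpha\otimes x_\beta\otimes[y_\alpha,y_\beta]\big)$. A Novikov coalgebra $(A,\Delta)$: $\Delta:A\to A\otimes A$ linear with $(\mathrm{id}\otimes\Delta)\Delta(a)-(\tau\otimes\mathrm{id})(\mathrm{id}\otimes\Delta)\Delta(a)=(\Delta\otimes\mathrm{id})\Delta(a)-(\tau\otimes\mathrm{id})(\Delta\otimes\mathrm{id})\Delta(a)$ and $(\tau\otimes\mathrm{id})(\mathrm{id}\otimes\Delta)\tau\Delta(a)=(\Delta\otimes\mathrm{id})\Delta(a)$. A Lie coalgebra $(A,\delta)$: $\delta=-\tau\delta$ and $(\mathrm{id}\otimes\delta)\delta-(\tau\otimes\mathrm{id})(\mathrm{id}\otimes\delta)\delta=(\delta\otimes\mathrm{id})\delta$. A GD coalgebra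 $(A,\Delta,\delta)$: $(A,\Delta)$ is a Novikov coalgebra, $(A,\delta)$ is a Lie coalgebra, and $(\mathrm{id}\otimes\delta)\Delta(a)-(\tau\otimes\mathrm{id})(\mathrm{id}\otimes\Delta)\delta(a)+(\tau\otimes\mathrm{id})(\mathrm{id}\otimes\delta)\tau\Delta(a)=(\Delta\otimes\mathrm{id})\delta(a)+(\delta\otimes\mathrm{id})\Delta(a)$. A Novikov bialgebra $(A,\circ,\Delta)$: $(A,\circ)$ is a Novikov algebra, $(A,\Delta)$ is a Novikov coalgebra, and for all $a,b$: $\Delta(a\circ b)=(R_\circ(b)\otimes\mathrm{id})\Delta(a)+(\mathrm{id}\otimes L_\star(a))(\Delta(b)+\tau\Delta(b))$; $(L_\star(a)\otimes\mathrm{id})\Delta(b)-(\mathrm{id}\otimes L_\star(a))\tau\Delta(b)=(L_\star(b)\otimes\mathrm{id})\Delta(a)-(\mathrm{id}\otimes L_\star(b))\tau\Delta(a)$; $(\mathrm{id}\otimes R_\circ(a)-R_\circ(a)\otimes\mathrm{id})(\Delta(b)+\tau\Delta(b))=(\mathrm{id}\otimes R_\circ(b)-R_\circ(b)\otimes\mathrm{id})(\Delta(a)+\tau\Delta(a))$. A Lie bialgebra $(A,[\cdot,\cdot],\delta)$: a Lie algebra and Lie coalgebra with $\delta([a,b])=a.\delta(b)-b.\delta(a)$. A GD bialgebra $(A,\circ,[\cdot,\cdot],\Delta,\delta)$: $(A,\circ,[\cdot,\cdot])$ is a GD algebra, $(A,\Delta,\delta)$ is a GD coalgebra, $(A,\circ,\Delta)$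 is a Novikov bialgebra, $(A,[\cdot,\cdot],\delta)$ is a Lie bialgebra, and for all $a,b$ $$\delta(b\circ a)+\Delta([a,b])=(R_\circ(a)\otimes\mathrm{id})\delta(b)+(L_\circ(b)\otimes\mathrm{id})\delta(a)+(\mathrm{id}\otimes L_\star(b))\delta(a)+a.\Delta(b)-(\mathrm{id}\otimes\mathrm{ad}(b))(\Delta(a)+\tau\Delta(a)).$$ *)

theory Defs
  imports Complex_Main "HOL-Library.Poly_Mapping"
begin

section \<open>Formal sums\<close>

text \<open>
  \<open>'x \<Rightarrow>\<^sub>0 'k\<close> is the free \<open>'k\<close>-vector space on \<open>'x\<close>; \<open>lin f\<close> is the linear extension of a map
  \<open>f\<close> on generators, and \<open>lin2 f\<close> the bilinear extension of a map on pairs of generators.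
\<close>

definition fscale :: "'k::field \<Rightarrow> ('x \<Rightarrow>\<^sub>0 'k) \<Rightarrow> ('x \<Rightarrow>\<^sub>0 'k)" where
  "fscale c p = Poly_Mapping.map ((*) c) p"

lemma lookup_fscale [simp]: "Poly_Mapping.lookup (fscale c p) x = c * Poly_Mapping.lookup p x"
  unfolding fscale_def by transfer (simp add: when_def)

global_interpretation free: vector_space "fscale :: 'k::field \<Rightarrow> ('x \<Rightarrow>\<^sub>0 'k) \<Rightarrow> _"
  by unfold_locales (auto intro!: poly_mapping_eqI simp: lookup_add algebra_simps)

definition lin :: "('x \<Rightarrow> ('y \<Rightarrow>\<^sub>0 'k)) \<Rightarrow> ('x \<Rightarrow>\<^sub>0 'k::field) \<Rightarrow> ('y \<Rightarrow>\<^sub>0 'k)" where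
  "lin f p = (\<Sum>x \<in> Poly_Mapping.keys p. fscale (Poly_Mapping.lookup p x) (f x))"

definition lin2 :: "('x \<Rightarrow> 'y \<Rightarrow> ('z \<Rightarrow>\<^sub>0 'k)) \<Rightarrow>
    ('x \<Rightarrow>\<^sub>0 'k::field) \<Rightarrow> ('y \<Rightarrow>\<^sub>0 'k) \<Rightarrow> ('z \<Rightarrow>\<^sub>0 'k)" where
  "lin2 f p q = lin (\<lambda>x. lin (\<lambda>y. f x y) q) p"


section \<open>Tensor squares and tensor cubes\<close>

text \<open>
  For a vector space \<open>A\<close> with scalar multiplication \<open>scale\<close> on the type \<open>'a\<close>, \<open>A \<otimes> A\<close> is the
  quotient of the free vector space on \<open>'a \<times> 'a\<close> by the subspace spanned by the usual bilinearity
  relations, and \<open>A \<otimes> A \<otimes> A\<close> the quotient of the free vector space on \<open>'a \<times> 'a \<times> 'a\<close> by the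
  trilinearity relations. Since these subspaces depend on \<open>scale\<close>, the quotients cannot be
  introduced as types; instead, tensors are given by formal sums and equality
  of tensors is congruence modulo the relations (\<open>tensor2_eq\<close>, \<open>tensor3_eq\<close>). A linear map
  \<open>A \<rightarrow> A \<otimes> A\<close> is accordingly a function into formal sums that is linear up to \<open>tensor2_eq\<close>.
\<close>

abbreviation pure2 :: "'a \<Rightarrow> 'a \<Rightarrow> ('a \<times> 'a \<Rightarrow>\<^sub>0 'k::field)" where
  "pure2 a b \<equiv> Poly_Mapping.single (a, b) 1"

abbreviation pure3 :: "'a \<Rightarrow> 'a \<Rightarrow> 'a \<Rightarrow> ('a \<times> 'a \<times> 'a \<Rightarrow>\<^sub>0 'k::field)" where
  "pure3 a b c \<equiv> Poly_Mapping.single (a, b, c) 1"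

definition tensor2_rel ::
    "('k::field \<Rightarrow> 'a::ab_group_add \<Rightarrow> 'a) \<Rightarrow> ('a \<times> 'a \<Rightarrow>\<^sub>0 'k) set" where
  "tensor2_rel scale = free.span
     ({pure2 (a + a') b - (pure2 a b + pure2 a' b) | a a' b. True} \<union>
      {pure2 a (b + b') - (pure2 a b + pure2 a b') | a b b'. True} \<union>
      {pure2 (scale s a) b - fscale s (pure2 a b) | s a b. True} \<union>
      {pure2 a (scale s b) - fscale s (pure2 a b) | s a b. True})"

definition tensor3_rel ::
    "('k::field \<Rightarrow> 'a::ab_group_add \<Rightarrow> 'a) \<Rightarrow> ('a \<times> 'a \<times> 'a \<Rightarrow>\<^sub>0 'k) set" where
  "tensor3_rel scale = free.span
     ({pure3 (a + a') b c - (pure3 a b c + pure3 a' b c) | a a' b c. True} \<union>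
      {pure3 a (b + b') c - (pure3 a b c + pure3 a b' c) | a b b' c. True} \<union>
      {pure3 a b (c + c') - (pure3 a b c + pure3 a b c') | a b c c'. True} \<union>
      {pure3 (scale s a) b c - fscale s (pure3 a b c) | s a b c. True} \<union>
      {pure3 a (scale s b) c - fscale s (pure3 a b c) | s a b c. True} \<union>
      {pure3 a b (scale s c) - fscale s (pure3 a b c) | s a b c. True})"

definition tensor2_eq :: "('k::field \<Rightarrow> 'a::ab_group_add \<Rightarrow> 'a) \<Rightarrow>
    ('a \<times> 'a \<Rightarrow>\<^sub>0 'k) \<Rightarrow> ('a \<times> 'a \<Rightarrow>\<^sub>0 'k) \<Rightarrow> bool" where
  "tensor2_eq scale p q \<longleftrightarrow> p - q \<in> tensor2_rel scale"

definition tensor3_eq :: "('k::field \<Rightarrow> 'a::ab_group_add \<Rightarrow> 'a) \<Rightarrow>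
    ('a \<times> 'a \<times> 'a \<Rightarrow>\<^sub>0 'k) \<Rightarrow> ('a \<times> 'a \<times> 'a \<Rightarrow>\<^sub>0 'k) \<Rightarrow> bool" where
  "tensor3_eq scale p q \<longleftrightarrow> p - q \<in> tensor3_rel scale"

text \<open>
  \<open>\<tau>\<close>, \<open>\<tau> \<otimes> id\<close>, \<open>f \<otimes> g\<close> for endomaps \<open>f\<close>, \<open>g\<close> of \<open>A\<close>, and \<open>id \<otimes> D\<close>, \<open>D \<otimes> id\<close> for
  \<open>D : A \<rightarrow> A \<otimes> A\<close>.
\<close>

definition tau :: "('a \<times> 'a \<Rightarrow>\<^sub>0 'k::field) \<Rightarrow> ('a \<times> 'a \<Rightarrow>\<^sub>0 'k)" where
  "tau = lin (\<lambda>(a, b). pure2 b a)"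

definition tau_id :: "('a \<times> 'a \<times> 'a \<Rightarrow>\<^sub>0 'k::field) \<Rightarrow> ('a \<times> 'a \<times> 'a \<Rightarrow>\<^sub>0 'k)" where
  "tau_id = lin (\<lambda>(a, b, c). pure3 b a c)"

definition tensor_map :: "('a \<Rightarrow> 'a) \<Rightarrow> ('a \<Rightarrow> 'a) \<Rightarrow>
    ('a \<times> 'a \<Rightarrow>\<^sub>0 'k::field) \<Rightarrow> ('a \<times> 'a \<Rightarrow>\<^sub>0 'k)" where
  "tensor_map f g = lin (\<lambda>(a, b). pure2 (f a) (g b))"

definition id_tensor :: "('a \<Rightarrow> ('a \<times> 'a \<Rightarrow>\<^sub>0 'k::field)) \<Rightarrow>
    ('a \<times> 'a \<Rightarrow>\<^sub>0 'k) \<Rightarrow> ('a \<times> 'a \<times> 'a \<Rightarrow>\<^sub>0 'k)" where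
  "id_tensor D = lin (\<lambda>(a, b). lin (\<lambda>(b\<^sub>1, b\<^sub>2). pure3 a b\<^sub>1 b\<^sub>2) (D b))"

definition tensor_id :: "('a \<Rightarrow> ('a \<times> 'a \<Rightarrow>\<^sub>0 'k::field)) \<Rightarrow>
    ('a \<times> 'a \<Rightarrow>\<^sub>0 'k) \<Rightarrow> ('a \<times> 'a \<times> 'a \<Rightarrow>\<^sub>0 'k)" where
  "tensor_id D = lin (\<lambda>(a, b). lin (\<lambda>(a\<^sub>1, a\<^sub>2). pure3 a\<^sub>1 a\<^sub>2 b) (D a))"

definition skew_symmetric :: "('k::field \<Rightarrow> 'a::ab_group_add \<Rightarrow> 'a) \<Rightarrow>
    ('a \<times> 'a \<Rightarrow>\<^sub>0 'k) \<Rightarrow> bool" where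
  "skew_symmetric scale r \<longleftrightarrow> tensor2_eq scale (r + tau r) 0"


section \<open>Algebras\<close>

locale fin_dim_space =
  fixes scale :: "'k::field_char_0 \<Rightarrow> 'a::ab_group_add \<Rightarrow> 'a"  (infixr \<open>*s\<close> 75)
  assumes fin_dim: "\<exists>Basis. finite_dimensional_vector_space scale Basis"
begin

abbreviation teq2 (infix \<open>\<approx>\<^sub>2\<close> 50) where "p \<approx>\<^sub>2 q \<equiv> tensor2_eq scale p q"
abbreviation teq3 (infix \<open>\<approx>\<^sub>3\<close> 50) where "p \<approx>\<^sub>3 q \<equiv> tensor3_eq scale p q"

end

definition sym_prod :: "('a \<Rightarrow> 'a \<Rightarrow> 'a) \<Rightarrow> 'a \<Rightarrow> 'a \<Rightarrow> 'a::ab_group_add" where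
  "sym_prod circ a b = circ a b + circ b a"

definition bilinear_op ::
    "('k::field \<Rightarrow> 'a::ab_group_add \<Rightarrow> 'a) \<Rightarrow> ('a \<Rightarrow> 'a \<Rightarrow> 'a) \<Rightarrow> bool" where
  "bilinear_op scale m \<longleftrightarrow>
     (\<forall>a. Vector_Spaces.linear scale scale (\<lambda>b. m a b)) \<and>
     (\<forall>b. Vector_Spaces.linear scale scale (\<lambda>a. m a b))"

locale novikov_algebra = fin_dim_space scale
  for scale :: "'k::field_char_0 \<Rightarrow> 'a::ab_group_add \<Rightarrow> 'a"  (infixr \<open>*s\<close> 75) +
  fixes circ :: "'a \<Rightarrow> 'a \<Rightarrow> 'a"  (infixl \<open>\<odot>\<close> 70)
  assumes circ_bilinear: "bilinear_op scale circ"
    and left_symmetric: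
      "(a \<odot> b) \<odot> c - a \<odot> (b \<odot> c) = (b \<odot> a) \<odot> c - b \<odot> (a \<odot> c)"
    and right_commutative: "(a \<odot> b) \<odot> c = (a \<odot> c) \<odot> b"

locale lie_algebra = fin_dim_space scale
  for scale :: "'k::field_char_0 \<Rightarrow> 'a::ab_group_add \<Rightarrow> 'a"  (infixr \<open>*s\<close> 75) +
  fixes lie :: "'a \<Rightarrow> 'a \<Rightarrow> 'a"  (\<open>\<lbrace>_, _\<rbrace>\<close>)
  assumes lie_bilinear: "bilinear_op scale lie"
    and lie_alternating: "\<lbrace>a, a\<rbrace> = 0"
    and lie_jacobi: "\<lbrace>a, \<lbrace>b, c\<rbrace>\<rbrace> + \<lbrace>b, \<lbrace>c, a\<rbrace>\<rbrace> + \<lbrace>c, \<lbrace>a, b\<rbrace>\<rbrace> = 0"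

locale gd_algebra = novikov_algebra scale circ + lie_algebra scale lie
  for scale :: "'k::field_char_0 \<Rightarrow> 'a::ab_group_add \<Rightarrow> 'a"  (infixr \<open>*s\<close> 75)
    and circ :: "'a \<Rightarrow> 'a \<Rightarrow> 'a"  (infixl \<open>\<odot>\<close> 70)
    and lie :: "'a \<Rightarrow> 'a \<Rightarrow> 'a"  (\<open>\<lbrace>_, _\<rbrace>\<close>) +
  assumes gd_compat:
    "\<lbrace>a \<odot> b, c\<rbrace> - \<lbrace>a \<odot> c, b\<rbrace> + \<lbrace>a, b\<rbrace> \<odot> c - \<lbrace>a, c\<rbrace> \<odot> b - a \<odot> \<lbrace>b, c\<rbrace> = 0"


section \<open>Coalgebras\<close>

definition colinear :: "('k::field \<Rightarrow> 'a::ab_group_add \<Rightarrow> 'a) \<Rightarrow>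
    ('a \<Rightarrow> ('a \<times> 'a \<Rightarrow>\<^sub>0 'k)) \<Rightarrow> bool" where
  "colinear scale D \<longleftrightarrow>
     (\<forall>a b. tensor2_eq scale (D (a + b)) (D a + D b)) \<and>
     (\<forall>c a. tensor2_eq scale (D (scale c a)) (fscale c (D a)))"

locale novikov_coalgebra = fin_dim_space scale
  for scale :: "'k::field_char_0 \<Rightarrow> 'a::ab_group_add \<Rightarrow> 'a"  (infixr \<open>*s\<close> 75) +
  fixes \<Delta> :: "'a \<Rightarrow> ('a \<times> 'a \<Rightarrow>\<^sub>0 'k)"
  assumes Delta_linear: "colinear scale \<Delta>"
    and Delta_left_symmetric:
      "id_tensor \<Delta> (\<Delta> a) - tau_id (id_tensor \<Delta> (\<Delta> a))
         \<approx>\<^sub>3 tensor_id \<Delta> (\<Delta> a) - tau_id (tensor_id \<Delta> (\<Delta> a))"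
    and Delta_right_commutative:
      "tau_id (id_tensor \<Delta> (tau (\<Delta> a))) \<approx>\<^sub>3 tensor_id \<Delta> (\<Delta> a)"

locale lie_coalgebra = fin_dim_space scale
  for scale :: "'k::field_char_0 \<Rightarrow> 'a::ab_group_add \<Rightarrow> 'a"  (infixr \<open>*s\<close> 75) +
  fixes \<delta> :: "'a \<Rightarrow> ('a \<times> 'a \<Rightarrow>\<^sub>0 'k)"
  assumes delta_linear: "colinear scale \<delta>"
    and delta_skew: "\<delta> a \<approx>\<^sub>2 - tau (\<delta> a)"
    and delta_jacobi:
      "id_tensor \<delta> (\<delta> a) - tau_id (id_tensor \<delta> (\<delta> a)) \<approx>\<^sub>3 tensor_id \<delta> (\<delta> a)"

locale gd_coalgebra = novikov_coalgebra scale \<Delta> + lie_coalgebra scale \<delta>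
  for scale :: "'k::field_char_0 \<Rightarrow> 'a::ab_group_add \<Rightarrow> 'a"  (infixr \<open>*s\<close> 75)
    and \<Delta> \<delta> :: "'a \<Rightarrow> ('a \<times> 'a \<Rightarrow>\<^sub>0 'k)" +
  assumes gd_cocompat:
    "id_tensor \<delta> (\<Delta> a) - tau_id (id_tensor \<Delta> (\<delta> a)) + tau_id (id_tensor \<delta> (tau (\<Delta> a)))
       \<approx>\<^sub>3 tensor_id \<Delta> (\<delta> a) + tensor_id \<delta> (\<Delta> a)"


section \<open>Bialgebras\<close>

text \<open>The adjoint action \<open>a.(b \<otimes> c) = [a, b] \<otimes> c + b \<otimes> [a, c]\<close>.\<close>

definition lie_act :: "('a \<Rightarrow> 'a \<Rightarrow> 'a) \<Rightarrow> 'a \<Rightarrow>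
    ('a \<times> 'a \<Rightarrow>\<^sub>0 'k::field) \<Rightarrow> ('a \<times> 'a \<Rightarrow>\<^sub>0 'k)" where
  "lie_act lie a = lin (\<lambda>(b, c). pure2 (lie a b) c + pure2 b (lie a c))"

locale novikov_bialgebra = novikov_algebra scale circ + novikov_coalgebra scale \<Delta>
  for scale :: "'k::field_char_0 \<Rightarrow> 'a::ab_group_add \<Rightarrow> 'a"  (infixr \<open>*s\<close> 75)
    and circ :: "'a \<Rightarrow> 'a \<Rightarrow> 'a"  (infixl \<open>\<odot>\<close> 70)
    and \<Delta> :: "'a \<Rightarrow> ('a \<times> 'a \<Rightarrow>\<^sub>0 'k)" +
  assumes Delta_circ:
      "\<Delta> (a \<odot> b) \<approx>\<^sub>2 tensor_map (\<lambda>x. x \<odot> b) id (\<Delta> a)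
         + tensor_map id (sym_prod circ a) (\<Delta> b + tau (\<Delta> b))"
    and Delta_L_star:
      "tensor_map (sym_prod circ a) id (\<Delta> b) - tensor_map id (sym_prod circ a) (tau (\<Delta> b))
         \<approx>\<^sub>2 tensor_map (sym_prod circ b) id (\<Delta> a) - tensor_map id (sym_prod circ b) (tau (\<Delta> a))"
    and Delta_R:
      "tensor_map id (\<lambda>x. x \<odot> a) (\<Delta> b + tau (\<Delta> b)) - tensor_map (\<lambda>x. x \<odot> a) id (\<Delta> b + tau (\<Delta> b))
         \<approx>\<^sub>2 tensor_map id (\<lambda>x. x \<odot> b) (\<Delta> a + tau (\<Delta> a)) - tensor_map (\<lambda>x. x \<odot> b) id (\<Delta> a + tau (\<Delta> a))"

locale lie_bialgebra = lie_algebra scale lie + lie_coalgebra scale \<delta>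
  for scale :: "'k::field_char_0 \<Rightarrow> 'a::ab_group_add \<Rightarrow> 'a"  (infixr \<open>*s\<close> 75)
    and lie :: "'a \<Rightarrow> 'a \<Rightarrow> 'a"  (\<open>\<lbrace>_, _\<rbrace>\<close>)
    and \<delta> :: "'a \<Rightarrow> ('a \<times> 'a \<Rightarrow>\<^sub>0 'k)" +
  assumes delta_cocycle: "\<delta> \<lbrace>a, b\<rbrace> \<approx>\<^sub>2 lie_act lie a (\<delta> b) - lie_act lie b (\<delta> a)"

locale gd_bialgebra = gd_algebra scale circ lie + gd_coalgebra scale \<Delta> \<delta> +
    novikov_bialgebra scale circ \<Delta> + lie_bialgebra scale lie \<delta>
  for scale :: "'k::field_char_0 \<Rightarrow> 'a::ab_group_add \<Rightarrow> 'a"  (infixr \<open>*s\<close> 75)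
    and circ :: "'a \<Rightarrow> 'a \<Rightarrow> 'a"  (infixl \<open>\<odot>\<close> 70)
    and lie :: "'a \<Rightarrow> 'a \<Rightarrow> 'a"  (\<open>\<lbrace>_, _\<rbrace>\<close>)
    and \<Delta> \<delta> :: "'a \<Rightarrow> ('a \<times> 'a \<Rightarrow>\<^sub>0 'k)" +
  assumes gd_bialgebra_compat:
    "\<delta> (b \<odot> a) + \<Delta> \<lbrace>a, b\<rbrace> \<approx>\<^sub>2
       tensor_map (\<lambda>x. x \<odot> a) id (\<delta> b) + tensor_map (\<lambda>x. b \<odot> x) id (\<delta> a)
       + tensor_map id (sym_prod circ b) (\<delta> a) + lie_act lie a (\<Delta> b)
       - tensor_map id (lie b) (\<Delta> a + tau (\<Delta> a))"


section \<open>The Gel'fand-Dorfman Yang-Baxter equation\<close>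

text \<open>In the sums over pairs of terms of \<open>r\<close>, \<open>(x, y)\<close> has index \<open>\<alpha>\<close> and \<open>(x', y')\<close> index \<open>\<beta>\<close>.\<close>

definition NN :: "('a \<Rightarrow> 'a \<Rightarrow> 'a::ab_group_add) \<Rightarrow>
    ('a \<times> 'a \<Rightarrow>\<^sub>0 'k::field) \<Rightarrow> ('a \<times> 'a \<times> 'a \<Rightarrow>\<^sub>0 'k)" where
  "NN circ r = lin2 (\<lambda>(x, y) (x', y').
     pure3 x x' (circ y y') + pure3 x (sym_prod circ y x') y' + pure3 (circ x x') y' y) r r"

definition CC :: "('a \<Rightarrow> 'a \<Rightarrow> 'a::ab_group_add) \<Rightarrow>
    ('a \<times> 'a \<Rightarrow>\<^sub>0 'k::field) \<Rightarrow> ('a \<times> 'a \<times> 'a \<Rightarrow>\<^sub>0 'k)" where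
  "CC lie r = lin2 (\<lambda>(x, y) (x', y').
     pure3 (lie x x') y y' + pure3 x (lie y x') y' + pure3 x x' (lie y y')) r r"

definition GDYBE :: "('k::field \<Rightarrow> 'a::ab_group_add \<Rightarrow> 'a) \<Rightarrow> ('a \<Rightarrow> 'a \<Rightarrow> 'a) \<Rightarrow>
    ('a \<Rightarrow> 'a \<Rightarrow> 'a) \<Rightarrow> ('a \<times> 'a \<Rightarrow>\<^sub>0 'k) \<Rightarrow> bool" where
  "GDYBE scale circ lie r \<longleftrightarrow>
     tensor3_eq scale (NN circ r) 0 \<and> tensor3_eq scale (CC lie r) 0"

definition Delta_r :: "('a \<Rightarrow> 'a \<Rightarrow> 'a::ab_group_add) \<Rightarrow>
    ('a \<times> 'a \<Rightarrow>\<^sub>0 'k::field) \<Rightarrow> 'a \<Rightarrow> ('a \<times> 'a \<Rightarrow>\<^sub>0 'k)" where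
  "Delta_r circ r a = - (tensor_map (circ a) id r + tensor_map id (sym_prod circ a) r)"

definition delta_r :: "('a \<Rightarrow> 'a \<Rightarrow> 'a::ab_group_add) \<Rightarrow>
    ('a \<times> 'a \<Rightarrow>\<^sub>0 'k::field) \<Rightarrow> 'a \<Rightarrow> ('a \<times> 'a \<Rightarrow>\<^sub>0 'k)" where
  "delta_r lie r a = tensor_map (lie a) id r + tensor_map id (lie a) r"

end

theory Submission
  imports Defs
begin

text \<open>
  Read \<open>r\<close> as the operator \<open>R : A\<^sup>* \<rightarrow> A\<close>, \<open>R f = \<Sum> f(x\<^sub>\<alpha>) y\<^sub>\<alpha>\<close>. Skew-symmetry says
  \<open>g (R f) = - f (R g)\<close>. A tensor is determined by its values on functionals
  (\<open>tensor2_eq_iff\<close>, \<open>tensor3_eq_iff\<close>), and \<open>\<Delta>\<^sub>r\<close>, \<open>\<delta>\<^sub>r\<close> become two operations on \<open>A\<^sup>*\<close>,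
  \<open>(f \<cdot> g)(a) = f (a \<circ> R g) - g (a \<star> R f)\<close> and \<open>{f, g}(a) = g [a, R f] - f [a, R g]\<close>,
  in which no sum over the terms of \<open>r\<close> is left.

  Evaluated on three functionals, the equations \<open>N(r) = 0\<close> and \<open>C(r) = 0\<close> say that \<open>R\<close> is a
  homomorphism, \<open>R (f \<cdot> g) = R f \<circ> R g\<close> and \<open>R {f, g} = [R f, R g]\<close> (\<open>R_dual_circ\<close>,
  \<open>R_dual_lie\<close>). This makes an iterated product such as \<open>(f \<cdot> (g \<cdot> h))(a)\<close> a sum of \<open>f\<close>, \<open>g\<close> and
  \<open>h\<close>, each applied to an expression in \<open>a\<close>, \<open>R f\<close>, \<open>R g\<close>, \<open>R h\<close>. Each coalgebra axiom
  therefore holds as soon as the arguments of \<open>f\<close>, of \<open>g\<close> and of \<open>h\<close> agree on both sides, and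
  these are identities in the algebra \<open>A\<close>: \<open>star_circ\<close>, \<open>circ_circ\<close>, \<open>star_star\<close>, \<open>lie_lie\<close>,
  \<open>circ_lie\<close> and \<open>lie_circ\<close>.

  The compatibility conditions between products and coproducts are linear in \<open>r\<close> and follow
  from skew-symmetry. It gives \<open>\<Delta>\<^sub>r(a) + \<tau> \<Delta>\<^sub>r(a) = (R\<^sub>\<circ>(a) \<otimes> id - id \<otimes> R\<^sub>\<circ>(a)) r\<close>
  (\<open>ev2_Delta_symmetrized\<close>); afterwards both sides are of the form \<open>\<Sum> S(x\<^sub>\<alpha>) \<otimes> T(y\<^sub>\<alpha>)\<close>, and the
  same algebra identities, applied to each tensor factor, match them.
\<close>

section \<open>Linear forms on formal sums\<close>

definition pairing :: "('x \<Rightarrow> 'k::field) \<Rightarrow> ('x \<Rightarrow>\<^sub>0 'k) \<Rightarrow> 'k" where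
  "pairing \<phi> p = (\<Sum>x \<in> Poly_Mapping.keys p. Poly_Mapping.lookup p x * \<phi> x)"

lemma pairing_superset:
  assumes "finite S" "Poly_Mapping.keys p \<subseteq> S"
  shows "pairing \<phi> p = (\<Sum>x\<in>S. Poly_Mapping.lookup p x * \<phi> x)"
  unfolding pairing_def using assms by (intro sum.mono_neutral_left) (auto simp: in_keys_iff)

lemma pairing_add [simp]: "pairing \<phi> (p + q) = pairing \<phi> p + pairing \<phi> q"
proof -
  let ?S = "Poly_Mapping.keys p \<union> Poly_Mapping.keys q"
  have "pairing \<phi> (p + q) = (\<Sum>x\<in>?S. Poly_Mapping.lookup (p + q) x * \<phi> x)"
    by (intro pairing_superset) (auto simp: Poly_Mapping.keys_add)
  moreover have "pairing \<phi> p = (\<Sum>x\<in>?S. Poly_Mapping.lookup p x * \<phi> x)"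
    "pairing \<phi> q = (\<Sum>x\<in>?S. Poly_Mapping.lookup q x * \<phi> x)"
    by (auto intro!: pairing_superset)
  ultimately show ?thesis by (simp add: lookup_add sum.distrib algebra_simps)
qed

lemma pairing_fscale [simp]: "pairing \<phi> (fscale c p) = c * pairing \<phi> p"
proof -
  have "pairing \<phi> (fscale c p) =
      (\<Sum>x\<in>Poly_Mapping.keys p. Poly_Mapping.lookup (fscale c p) x * \<phi> x)"
    by (intro pairing_superset) (auto simp: in_keys_iff)
  then show ?thesis by (simp add: pairing_def sum_distrib_left algebra_simps)
qed

lemma pairing_zero [simp]: "pairing \<phi> 0 = 0"
  by (simp add: pairing_def)

lemma pairing_uminus [simp]: "pairing \<phi> (- p) = - pairing \<phi> p"
  using pairing_add [of \<phi> p "- p"] by (simp add: add_eq_0_iff)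

lemma pairing_diff [simp]: "pairing \<phi> (p - q) = pairing \<phi> p - pairing \<phi> q"
  using pairing_add [of \<phi> p "- q"] by simp

lemma pairing_sum: "pairing \<phi> (\<Sum>i\<in>I. F i) = (\<Sum>i\<in>I. pairing \<phi> (F i))"
  by (induction I rule: infinite_finite_induct) auto

lemma pairing_single [simp]: "pairing \<phi> (Poly_Mapping.single x 1) = \<phi> x"
  by (simp add: pairing_def)

lemma pairing_lin: "pairing \<phi> (lin F p) = pairing (\<lambda>x. pairing \<phi> (F x)) p"
  unfolding lin_def pairing_sum pairing_fscale by (rule pairing_def [symmetric])

lemma pairing_fun_add: "pairing (\<lambda>x. \<phi> x + \<psi> x) p = pairing \<phi> p + pairing \<psi> p"
  by (simp add: pairing_def sum.distrib algebra_simps)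

lemma pairing_fun_mult: "pairing (\<lambda>x. c * \<phi> x) p = c * pairing \<phi> p"
  by (simp add: pairing_def sum_distrib_left algebra_simps)

lemma pairing_fun_sum: "pairing (\<lambda>x. \<Sum>i\<in>I. \<phi> i x) p = (\<Sum>i\<in>I. pairing (\<phi> i) p)"
  unfolding pairing_def sum_distrib_left by (rule sum.swap)

lemma linear_eq_pairing:
  assumes "Vector_Spaces.linear fscale (*) \<Phi>"
  shows "\<Phi> p = pairing (\<lambda>x. \<Phi> (Poly_Mapping.single x 1)) p"
proof -
  interpret Vector_Spaces.linear fscale "(*)" \<Phi> by fact
  have "p = (\<Sum>x\<in>Poly_Mapping.keys p.
      fscale (Poly_Mapping.lookup p x) (Poly_Mapping.single x 1))"
    by (rule poly_mapping_eqI) (auto simp: lookup_sum lookup_single when_def in_keys_iff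
        if_distrib cong: if_cong)
  then have "\<Phi> p = \<Phi> (\<Sum>x\<in>Poly_Mapping.keys p.
      fscale (Poly_Mapping.lookup p x) (Poly_Mapping.single x 1))" by (rule arg_cong)
  then show ?thesis by (simp add: sum scale pairing_def)
qed

lemma pairing_vanishes_on_span:
  assumes "\<And>q. q \<in> S \<Longrightarrow> pairing \<phi> q = 0" "p \<in> free.span S"
  shows "pairing \<phi> p = 0"
  using assms(2) by (induction rule: free.span_induct_alt) (auto simp: assms(1))

text \<open>
  Otherwise extend a basis of the span by \<open>p\<close>: the linear form that is \<open>0\<close> on the basis and \<open>1\<close>
  at \<open>p\<close> extends to the whole free space, and every such form is a pairing.
\<close>

lemma in_span_if_pairings_vanish:
  assumes "\<And>\<phi>. (\<And>q. q \<in> S \<Longrightarrow> pairing \<phi> q = 0) \<Longrightarrow> pairing \<phi> p = 0"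
  shows "p \<in> free.span S"
proof (rule ccontr)
  assume p: "p \<notin> free.span S"
  interpret K: vector_space "(*) :: 'b \<Rightarrow> 'b \<Rightarrow> 'b"
    by unfold_locales (auto simp: algebra_simps)
  interpret P: vector_space_pair "fscale :: 'b \<Rightarrow> ('a \<Rightarrow>\<^sub>0 'b) \<Rightarrow> _" "(*) :: 'b \<Rightarrow> 'b \<Rightarrow> 'b" ..
  obtain B where B: "B \<subseteq> S" "free.independent B" "S \<subseteq> free.span B"
    using free.maximal_independent_subset by blast
  then have SB: "free.span S = free.span B"
    by (metis free.span_mono free.span_span subset_antisym)
  then have "free.independent (insert p B)"
    using B p by (simp add: free.independent_insert)
  then obtain \<Phi> where \<Phi>: "Vector_Spaces.linear fscale (*) \<Phi>"
      "\<forall>x \<in> insert p B. \<Phi> x = (if x = p then 1 else 0)"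
    using P.linear_independent_extend [of "insert p B" "\<lambda>x. if x = p then 1 else 0"] by blast
  define \<phi> where "\<phi> = (\<lambda>x. \<Phi> (Poly_Mapping.single x 1))"
  have eq: "\<Phi> q = pairing \<phi> q" for q
    unfolding \<phi>_def by (rule linear_eq_pairing [OF \<Phi>(1)])
  have "pairing \<phi> q = 0" if "q \<in> B" for q
    using \<Phi>(2) that p SB free.span_base [of q B] eq by auto
  then have "pairing \<phi> q = 0" if "q \<in> S" for q
    using pairing_vanishes_on_span B(3) that by blast
  then have "pairing \<phi> p = 0" by (rule assms)
  then show False using \<Phi>(2) eq by simp
qed


section \<open>Testing tensors on functionals\<close>

definition ev2 :: "('a \<Rightarrow> 'k) \<Rightarrow> ('a \<Rightarrow> 'k) \<Rightarrow> ('a \<times> 'a \<Rightarrow>\<^sub>0 'k::field) \<Rightarrow> 'k" where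
  "ev2 f g = pairing (\<lambda>(a, b). f a * g b)"

definition ev3 :: "('a \<Rightarrow> 'k) \<Rightarrow> ('a \<Rightarrow> 'k) \<Rightarrow> ('a \<Rightarrow> 'k) \<Rightarrow> ('a \<times> 'a \<times> 'a \<Rightarrow>\<^sub>0 'k::field) \<Rightarrow> 'k" where
  "ev3 f g h = pairing (\<lambda>(a, b, c). f a * g b * h c)"

lemma ev2_simps [simp]:
  "ev2 f g (p + q) = ev2 f g p + ev2 f g q"
  "ev2 f g (p - q) = ev2 f g p - ev2 f g q"
  "ev2 f g (- p) = - ev2 f g p"
  "ev2 f g (fscale c p) = c * ev2 f g p"
  "ev2 f g 0 = 0"
  "ev2 f g (pure2 a b) = f a * g b"
  by (simp_all add: ev2_def)

lemma ev3_simps [simp]: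
  "ev3 f g h (p + q) = ev3 f g h p + ev3 f g h q"
  "ev3 f g h (p - q) = ev3 f g h p - ev3 f g h q"
  "ev3 f g h (- p) = - ev3 f g h p"
  "ev3 f g h (fscale s p) = s * ev3 f g h p"
  "ev3 f g h 0 = 0"
  "ev3 f g h (pure3 a b c) = f a * g b * h c"
  by (simp_all add: ev3_def)

text \<open>
  Under evaluation, all tensor operations act on the functionals. Because these rules hold for
  arbitrary functions in place of functionals, they rewrite under binders without side conditions.
\<close>

lemma ev2_tau [simp]: "ev2 f g (tau p) = ev2 g f p"
  by (simp add: ev2_def tau_def pairing_lin split_def mult.commute)

lemma ev2_tensor_map [simp]:
  "ev2 f g (tensor_map F G p) = ev2 (\<lambda>x. f (F x)) (\<lambda>x. g (G x)) p"
  by (simp add: ev2_def tensor_map_def pairing_lin split_def)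

lemma ev2_lie_act [simp]:
  "ev2 f g (lie_act m a p) = ev2 (\<lambda>x. f (m a x)) g p + ev2 f (\<lambda>x. g (m a x)) p"
  by (simp add: ev2_def lie_act_def pairing_lin split_def pairing_fun_add)

lemma ev3_tau_id [simp]: "ev3 f g h (tau_id p) = ev3 g f h p"
  by (simp add: ev3_def tau_id_def pairing_lin split_def mult_ac)

lemma ev3_id_tensor [simp]: "ev3 f g h (id_tensor D p) = ev2 f (\<lambda>b. ev2 g h (D b)) p"
  by (simp add: ev2_def ev3_def id_tensor_def pairing_lin split_def pairing_fun_mult mult.assoc)

lemma ev3_tensor_id [simp]: "ev3 f g h (tensor_id D p) = ev2 (\<lambda>a. ev2 f g (D a)) h p"
proof -
  have "pairing (\<lambda>(a, b). f a * g b * h c) q = pairing (\<lambda>(a, b). f a * g b) q * h c" for c q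
    using pairing_fun_mult [of "h c" "\<lambda>(a, b). f a * g b" q] by (simp add: split_def mult_ac)
  then show ?thesis
    by (simp add: ev2_def ev3_def tensor_id_def pairing_lin split_def)
qed

lemma ev2_fun_add:
  "ev2 (\<lambda>x. f x + f' x) g p = ev2 f g p + ev2 f' g p"
  "ev2 f (\<lambda>x. g x + g' x) p = ev2 f g p + ev2 f g' p"
  unfolding ev2_def pairing_fun_add [symmetric] by (simp_all add: algebra_simps split_def)

lemma ev2_fun_scale:
  "ev2 (\<lambda>x. c * f x) g p = c * ev2 f g p"
  "ev2 f (\<lambda>x. c * g x) p = c * ev2 f g p"
  unfolding ev2_def pairing_fun_mult [symmetric] by (simp_all add: algebra_simps split_def)

lemma ev2_fun_uminus:
  "ev2 (\<lambda>x. - f x) g p = - ev2 f g p"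
  "ev2 f (\<lambda>x. - g x) p = - ev2 f g p"
  using ev2_fun_scale [where c = "-1"] by simp_all

lemma ev2_fun_diff:
  "ev2 (\<lambda>x. f x - f' x) g p = ev2 f g p - ev2 f' g p"
  "ev2 f (\<lambda>x. g x - g' x) p = ev2 f g p - ev2 f g' p"
  using ev2_fun_add(1) [of f "\<lambda>x. - f' x"] ev2_fun_add(2) [of f g "\<lambda>x. - g' x"]
  by (simp_all add: ev2_fun_uminus)

lemmas ev2_fun_linear = ev2_fun_add ev2_fun_diff ev2_fun_uminus

text \<open>
  This is \<open>f \<mapsto> (f \<otimes> id) r\<close>, the operator \<open>A\<^sup>* \<rightarrow> A\<close> that corresponds to \<open>r\<close>.
\<close>

definition sharp :: "('k::field \<Rightarrow> 'a::ab_group_add \<Rightarrow> 'a) \<Rightarrow> ('a \<times> 'a \<Rightarrow>\<^sub>0 'k) \<Rightarrow> ('a \<Rightarrow> 'k) \<Rightarrow> 'a" where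
  "sharp scale r f = (\<Sum>(x, y) \<in> Poly_Mapping.keys r. scale (Poly_Mapping.lookup r (x, y) * f x) y)"

context fin_dim_space
begin

lemma vector_space_scale: "vector_space scale"
  using fin_dim finite_dimensional_vector_space.axioms(1) by blast

definition functional :: "('a \<Rightarrow> 'k) \<Rightarrow> bool" where
  "functional f \<longleftrightarrow> (\<forall>a b. f (a + b) = f a + f b) \<and> (\<forall>c a. f (c *s a) = c * f a)"

lemma functionalI:
  "(\<And>a b. f (a + b) = f a + f b) \<Longrightarrow> (\<And>c a. f (c *s a) = c * f a) \<Longrightarrow> functional f"
  by (simp add: functional_def)

lemma functional_add: "functional f \<Longrightarrow> f (a + b) = f a + f b"
  and functional_scale: "functional f \<Longrightarrow> f (c *s a) = c * f a"
  by (simp_all add: functional_def)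

lemma functional_zero: "functional f \<Longrightarrow> f 0 = 0"
  using functional_add [of f 0 0] by simp

lemma functional_uminus: "functional f \<Longrightarrow> f (- a) = - f a"
  using functional_add [of f a "- a"] functional_zero [of f] by (simp add: add_eq_0_iff)

lemma functional_diff: "functional f \<Longrightarrow> f (a - b) = f a - f b"
  using functional_add [of f a "- b"] functional_uminus [of f b] by simp

lemma functional_sum: "functional f \<Longrightarrow> f (\<Sum>i\<in>I. F i) = (\<Sum>i\<in>I. f (F i))"
  by (induction I rule: infinite_finite_induct) (auto simp: functional_zero functional_add)

lemmas functional_linear = functional_add functional_diff functional_uminus functional_scale

text \<open>
  Finite dimension enters through a basis with its coordinate functionals.
\<close>

lemma coordinates:
  obtains E :: "'a set" and coord :: "'a \<Rightarrow> 'a \<Rightarrow> 'k"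
  where "\<And>u. functional (coord u)" "\<And>a. a = (\<Sum>u\<in>E. coord u a *s u)"
    "\<And>h a. functional h \<Longrightarrow> h a = (\<Sum>u\<in>E. coord u a * h u)"
proof -
  obtain E where "finite_dimensional_vector_space scale E" using fin_dim by blast
  then interpret V: finite_dimensional_vector_space scale E .
  define coord where "coord = (\<lambda>u a. V.representation E a u)"
  have "functional (coord u)" for u
    by (rule functionalI) (simp_all add: coord_def V.representation_add V.representation_scale
      V.independent_Basis V.span_Basis)
  moreover have exp: "a = (\<Sum>u\<in>E. coord u a *s u)" for a
    using V.sum_representation_eq [of E a E] by (simp add: coord_def V.independent_Basis V.span_Basis V.finite_Basis)
  moreover have "h a = (\<Sum>u\<in>E. coord u a * h u)" if "functional h" for h a
  proof -
    have "h a = h (\<Sum>u\<in>E. coord u a *s u)" using exp by (rule arg_cong)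
    then show ?thesis using that by (simp add: functional_sum functional_scale)
  qed
  ultimately show thesis using that by blast
qed

lemma functionals_separate:
  assumes "\<And>f. functional f \<Longrightarrow> f a = f b"
  shows "a = b"
proof -
  obtain E coord where *: "\<And>u. functional (coord u)" "\<And>a. a = (\<Sum>u\<in>E. coord u a *s u)"
    by (rule coordinates) blast
  have "(\<Sum>u\<in>E. coord u a *s u) = (\<Sum>u\<in>E. coord u b *s u)"
    using assms [OF *(1)] by simp
  then show ?thesis using *(2) by metis
qed

text \<open>
  A linear form \<open>\<phi>\<close> on formal sums that kills the bilinearity relations is a bilinear form on \<open>A\<close>.
  Expanding its first argument in coordinates writes \<open>\<phi>\<close> as a finite sum of products of two
  functionals, so products of functionals suffice to detect membership in the relations.
\<close>

lemma tensor2_eq_iff: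
  "p \<approx>\<^sub>2 q \<longleftrightarrow> (\<forall>f g. functional f \<longrightarrow> functional g \<longrightarrow> ev2 f g p = ev2 f g q)" (is "_ \<longleftrightarrow> ?R")
proof
  assume "p \<approx>\<^sub>2 q"
  then have pq: "p - q \<in> tensor2_rel scale" by (simp add: tensor2_eq_def)
  show ?R
  proof (intro allI impI)
    fix f g assume fgh: "functional f" "functional g"
    have "ev2 f g (p - q) = 0"
      unfolding ev2_def
      by (rule pairing_vanishes_on_span [OF _ pq [unfolded tensor2_rel_def]])
         (auto simp: functional_linear fgh distrib_left distrib_right mult_ac)
    then show "ev2 f g p = ev2 f g q" by simp
  qed
next
  assume R: ?R
  obtain E coord where C: "\<And>u. functional (coord u)"
    "\<And>h a. functional h \<Longrightarrow> h a = (\<Sum>u\<in>E. coord u a * h u)"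
    by (rule coordinates) blast
  show "p \<approx>\<^sub>2 q"
    unfolding tensor2_eq_def tensor2_rel_def
  proof (rule in_span_if_pairings_vanish, goal_cases)
    case (1 \<phi>)
    let ?T = "\<lambda>a b. \<phi> (a, b)"
    have T: "functional (\<lambda>a. ?T a b)" "functional (\<lambda>b. ?T a b)" for a b
    proof -
      have "pairing \<phi> (pure2 (x + x') b - (pure2 x b + pure2 x' b)) = 0"
        "pairing \<phi> (pure2 (c *s x) b - fscale c (pure2 x b)) = 0" for c x x'
        by (rule 1; blast)+
      then show "functional (\<lambda>a. ?T a b)"
        by (intro functionalI) simp_all
      have "pairing \<phi> (pure2 a (x + x') - (pure2 a x + pure2 a x')) = 0"
        "pairing \<phi> (pure2 a (c *s x) - fscale c (pure2 a x)) = 0" for c x x'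
        by (rule 1; blast)+
      then show "functional (\<lambda>b. ?T a b)"
        by (intro functionalI) simp_all
    qed
    have exp: "?T a b = (\<Sum>u\<in>E. coord u a * ?T u b)" for a b
      by (rule C(2) [OF T(1)])
    have "\<phi> = (\<lambda>(a, b). \<Sum>u\<in>E. coord u a * ?T u b)"
      by (intro ext, unfold split_paired_all prod.case, rule exp)
    then have "pairing \<phi> (p - q) = pairing (\<lambda>(a, b). \<Sum>u\<in>E. coord u a * ?T u b) (p - q)"
      by (rule arg_cong)
    also have "\<dots> = (\<Sum>u\<in>E. ev2 (coord u) (?T u) (p - q))"
      by (simp only: split_def pairing_fun_sum ev2_def)
    also have "\<dots> = 0"
      using R C(1) T(2) by (intro sum.neutral) simp
    finally show ?case .
  qed
qed

text \<open>
  As for two factors, with the first two arguments expanded in coordinates.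
\<close>

lemma tensor3_eq_iff:
  "p \<approx>\<^sub>3 q \<longleftrightarrow> (\<forall>f g h. functional f \<longrightarrow> functional g \<longrightarrow> functional h \<longrightarrow>
     ev3 f g h p = ev3 f g h q)" (is "_ \<longleftrightarrow> ?R")
proof
  assume "p \<approx>\<^sub>3 q"
  then have pq: "p - q \<in> tensor3_rel scale" by (simp add: tensor3_eq_def)
  show ?R
  proof (intro allI impI)
    fix f g h assume fgh: "functional f" "functional g" "functional h"
    have "ev3 f g h (p - q) = 0"
      unfolding ev3_def
      by (rule pairing_vanishes_on_span [OF _ pq [unfolded tensor3_rel_def]])
         (auto simp: functional_linear fgh distrib_left distrib_right mult_ac)
    then show "ev3 f g h p = ev3 f g h q" by simp
  qed
next
  assume R: ?R
  obtain E coord where C: "\<And>u. functional (coord u)"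
    "\<And>h a. functional h \<Longrightarrow> h a = (\<Sum>u\<in>E. coord u a * h u)"
    by (rule coordinates) blast
  show "p \<approx>\<^sub>3 q"
    unfolding tensor3_eq_def tensor3_rel_def
  proof (rule in_span_if_pairings_vanish, goal_cases)
    case (1 \<phi>)
    let ?T = "\<lambda>a b c. \<phi> (a, b, c)"
    have T: "functional (\<lambda>a. ?T a b c)" "functional (\<lambda>b. ?T a b c)" "functional (\<lambda>c. ?T a b c)"
      for a b c
    proof -
      have "pairing \<phi> (pure3 (x + x') b c - (pure3 x b c + pure3 x' b c)) = 0"
        "pairing \<phi> (pure3 (s *s x) b c - fscale s (pure3 x b c)) = 0" for s x x'
        by (rule 1, unfold Un_iff mem_Collect_eq, blast)+
      then show "functional (\<lambda>a. ?T a b c)"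
        by (intro functionalI) simp_all
      have "pairing \<phi> (pure3 a (x + x') c - (pure3 a x c + pure3 a x' c)) = 0"
        "pairing \<phi> (pure3 a (s *s x) c - fscale s (pure3 a x c)) = 0" for s x x'
        by (rule 1, unfold Un_iff mem_Collect_eq, blast)+
      then show "functional (\<lambda>b. ?T a b c)"
        by (intro functionalI) simp_all
      have "pairing \<phi> (pure3 a b (x + x') - (pure3 a b x + pure3 a b x')) = 0"
        "pairing \<phi> (pure3 a b (s *s x) - fscale s (pure3 a b x)) = 0" for s x x'
        by (rule 1, blast, rule 1, rule UnI2, blast)
      then show "functional (\<lambda>c. ?T a b c)"
        by (intro functionalI) simp_all
    qed
    have exp: "?T a b c = (\<Sum>u\<in>E. \<Sum>v\<in>E. coord u a * coord v b * ?T u v c)" for a b c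
    proof -
      have "?T a b c = (\<Sum>u\<in>E. coord u a * ?T u b c)"
        by (rule C(2) [OF T(1)])
      also have "\<dots> = (\<Sum>u\<in>E. coord u a * (\<Sum>v\<in>E. coord v b * ?T u v c))"
        by (intro sum.cong refl arg_cong [where f = "(*) _"] C(2) [OF T(2)])
      finally show ?thesis by (simp only: sum_distrib_left mult.assoc)
    qed
    have "\<phi> = (\<lambda>(a, b, c). \<Sum>u\<in>E. \<Sum>v\<in>E. coord u a * coord v b * ?T u v c)"
      by (intro ext, unfold split_paired_all prod.case, rule exp)
    then have "pairing \<phi> (p - q) =
        pairing (\<lambda>(a, b, c). \<Sum>u\<in>E. \<Sum>v\<in>E. coord u a * coord v b * ?T u v c) (p - q)"
      by (rule arg_cong)
    also have "\<dots> = (\<Sum>u\<in>E. \<Sum>v\<in>E. ev3 (coord u) (coord v) (?T u v) (p - q))"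
      by (simp only: split_def pairing_fun_sum ev3_def)
    also have "\<dots> = 0"
      using R C(1) T(3) by (intro sum.neutral ballI) simp
    finally show ?case .
  qed
qed

lemma functional_sharp: "functional g \<Longrightarrow> g (sharp scale r f) = ev2 f g r"
  by (simp add: sharp_def ev2_def pairing_def functional_sum functional_scale split_def mult.assoc)

lemma colinearI:
  assumes "\<And>f g. functional f \<Longrightarrow> functional g \<Longrightarrow> functional (\<lambda>a. ev2 f g (D a))"
  shows "colinear scale D"
  unfolding colinear_def tensor2_eq_iff
proof (intro conjI allI impI)
  fix f g a b c assume "functional f" "functional g"
  then have "functional (\<lambda>a. ev2 f g (D a))" by (rule assms)
  then show "ev2 f g (D (a + b)) = ev2 f g (D a + D b)"
    "ev2 f g (D (c *s a)) = ev2 f g (fscale c (D a))"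
    by (auto simp: functional_def)
qed

lemma skew_symmetric_iff:
  "skew_symmetric scale r \<longleftrightarrow>
     (\<forall>f g. functional f \<longrightarrow> functional g \<longrightarrow> ev2 f g r = - ev2 g f r)"
  by (simp add: skew_symmetric_def tensor2_eq_iff eq_neg_iff_add_eq_0)

lemma bilinear_op_simps:
  assumes "bilinear_op scale m"
  shows "m a (x + y) = m a x + m a y" "m (x + y) a = m x a + m y a"
    "m a (x - y) = m a x - m a y" "m (x - y) a = m x a - m y a"
    "m a (- x) = - m a x" "m (- x) a = - m x a"
    "m a (c *s x) = c *s m a x" "m (c *s x) a = c *s m x a"
proof -
  have 1: "m a (x + y) = m a x + m a y" "m (x + y) a = m x a + m y a"
    "m a (c *s x) = c *s m a x" "m (c *s x) a = c *s m x a" for x y c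
    using assms(1) by (auto simp: bilinear_op_def Vector_Spaces.linear_iff)
  have 2: "m a (- x) = - m a x" "m (- x) a = - m x a" for x
    using 1(1) [of x "-x"] 1(1) [of 0 0] 1(2) [of x "-x"] 1(2) [of 0 0]
    by (simp_all add: add_eq_0_iff)
  show "m a (x + y) = m a x + m a y" "m (x + y) a = m x a + m y a"
    "m a (x - y) = m a x - m a y" "m (x - y) a = m x a - m y a"
    "m a (- x) = - m a x" "m (- x) a = - m x a"
    "m a (c *s x) = c *s m a x" "m (c *s x) a = c *s m x a"
    using 1 2 1(1) [of x "- y"] 1(2) [of x "- y"] by simp_all
qed

lemma functional_mult:
  assumes "bilinear_op scale m" "functional f"
  shows "functional (\<lambda>x. f (m a x))" "functional (\<lambda>x. f (m x a))"
  by (rule functionalI; simp add: bilinear_op_simps [OF assms(1)] functional_linear assms(2))+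

end


section \<open>Identities in Gel'fand-Dorfman algebras\<close>

text \<open>
  The identities are solved for the terms that have to be eliminated, so that they can serve as
  rewrite rules.
\<close>

context novikov_algebra
begin

abbreviation star :: "'a \<Rightarrow> 'a \<Rightarrow> 'a"  (infixl \<open>\<star>\<close> 70) where
  "a \<star> b \<equiv> sym_prod circ a b"

lemmas circ_simps = bilinear_op_simps [OF circ_bilinear]

lemma sym_prod_commute: "a \<star> b = b \<star> a"
  by (simp add: sym_prod_def add.commute)

lemma bilinear_star: "bilinear_op scale (sym_prod circ)"
  using vector_space_scale
  by (simp add: bilinear_op_def Vector_Spaces.linear_iff sym_prod_def circ_simps
      vector_space.vector_space_assms(1) algebra_simps)

lemma left_symmetric_solved: "a \<odot> (b \<odot> c) = (a \<odot> b) \<odot> c - (b \<odot> a) \<odot> c + b \<odot> (a \<odot> c)"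
  using left_symmetric [of a b c] by (simp add: algebra_simps)

text \<open>
  The form in which the Novikov axioms act on second tensor legs: it says \<open>L\<^sub>\<star>(a) R\<^sub>\<circ>(c) = L\<^sub>\<star>(a \<circ> c)\<close>.
\<close>

lemma star_circ: "a \<star> (b \<odot> c) = (a \<odot> c) \<star> b"
  using right_commutative [of a b c] right_commutative [of b a c]
  by (simp add: sym_prod_def left_symmetric_solved [of a b c])

text \<open>
  Left symmetry of the dual product, read off at its first two arguments; \<open>star_star\<close> is the same
  law read off at the third.
\<close>

lemma circ_circ: "a \<odot> (b \<odot> c) = (a \<odot> c) \<odot> b + (a \<odot> c) \<star> b - (a \<star> b) \<odot> c"
  using right_commutative [of a b c] right_commutative [of b a c]
  by (simp add: sym_prod_def circ_simps left_symmetric_solved [of a b c])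

lemma star_star: "(a \<star> b) \<star> c = (a \<star> c) \<star> b - a \<star> (b \<odot> c) + a \<star> (c \<odot> b)"
proof -
  have "(b \<odot> a) \<star> c = (c \<odot> a) \<star> b"
    using star_circ [of c b a] sym_prod_commute [of c "b \<odot> a"] by simp
  then have "(a \<star> b) \<star> c = (a \<star> c) \<star> b - (a \<odot> c) \<star> b + (a \<odot> b) \<star> c"
    by (simp add: sym_prod_def [of circ a] bilinear_op_simps [OF bilinear_star])
  then show ?thesis by (simp add: star_circ)
qed

end

context lie_algebra
begin

lemmas lie_simps = bilinear_op_simps [OF lie_bilinear]

lemma lie_anti: "\<lbrace>b, a\<rbrace> = - \<lbrace>a, b\<rbrace>"
proof -
  have "\<lbrace>b, a\<rbrace> + \<lbrace>a, b\<rbrace> = 0"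
    using lie_alternating [of "a + b", unfolded lie_simps(1,2)]
    by (simp add: lie_alternating add.commute)
  then show ?thesis by (simp only: eq_neg_iff_add_eq_0)
qed

lemma lie_lie: "\<lbrace>a, \<lbrace>b, c\<rbrace>\<rbrace> = \<lbrace>\<lbrace>a, b\<rbrace>, c\<rbrace> - \<lbrace>\<lbrace>a, c\<rbrace>, b\<rbrace>"
  using lie_jacobi [of a b c]
  by (simp add: lie_anti [of c a] lie_anti [of b "\<lbrace>a, c\<rbrace>"] lie_anti [of c "\<lbrace>a, b\<rbrace>"]
      lie_simps(5) algebra_simps)

end

context gd_algebra
begin

lemma circ_lie:
  "a \<odot> \<lbrace>b, c\<rbrace> = \<lbrace>a \<odot> b, c\<rbrace> - \<lbrace>a \<odot> c, b\<rbrace> + \<lbrace>a, b\<rbrace> \<odot> c - \<lbrace>a, c\<rbrace> \<odot> b"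
  using gd_compat [of a b c] by simp

text \<open>
  The counterpart of \<open>circ_lie\<close> for \<open>\<star>\<close>, obtained by adding two instances of the
  Gel'fand-Dorfman identity with the roles of \<open>a\<close> and \<open>b\<close> exchanged.
\<close>

lemma lie_circ:
  "\<lbrace>a, b \<odot> c\<rbrace> = a \<star> \<lbrace>b, c\<rbrace> + \<lbrace>a, c\<rbrace> \<star> b + \<lbrace>a \<odot> c, b\<rbrace> - \<lbrace>a \<star> b, c\<rbrace>"
  by (simp add: sym_prod_def lie_simps circ_lie [of a b c] circ_lie [of b a c] circ_simps
      lie_anti [of "b \<odot> c" a] lie_anti [of b a])

end


section \<open>The dual operations\<close>

locale skew_gdybe_solution = gd_algebra scale circ lie
  for scale :: "'k::field_char_0 \<Rightarrow> 'a::ab_group_add \<Rightarrow> 'a"  (infixr \<open>*s\<close> 75)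
    and circ :: "'a \<Rightarrow> 'a \<Rightarrow> 'a"  (infixl \<open>\<odot>\<close> 70)
    and lie :: "'a \<Rightarrow> 'a \<Rightarrow> 'a"  (\<open>\<lbrace>_, _\<rbrace>\<close>) +
  fixes r :: "'a \<times> 'a \<Rightarrow>\<^sub>0 'k"
  assumes skew: "skew_symmetric scale r"
    and gdybe: "GDYBE scale circ lie r"
begin

abbreviation R :: "('a \<Rightarrow> 'k) \<Rightarrow> 'a" where "R \<equiv> sharp scale r"
abbreviation Delta :: "'a \<Rightarrow> ('a \<times> 'a \<Rightarrow>\<^sub>0 'k)" where "Delta \<equiv> Delta_r circ r"
abbreviation delta :: "'a \<Rightarrow> ('a \<times> 'a \<Rightarrow>\<^sub>0 'k)" where "delta \<equiv> delta_r lie r"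

text \<open>
  The operations on \<open>A\<^sup>*\<close> that are dual to \<open>\<Delta>\<^sub>r\<close> and \<open>\<delta>\<^sub>r\<close>; see \<open>ev2_Delta\<close> and \<open>ev2_delta\<close>.
\<close>

definition dual_circ :: "('a \<Rightarrow> 'k) \<Rightarrow> ('a \<Rightarrow> 'k) \<Rightarrow> 'a \<Rightarrow> 'k" where
  "dual_circ f g a = f (a \<odot> R g) - g (a \<star> R f)"

definition dual_lie :: "('a \<Rightarrow> 'k) \<Rightarrow> ('a \<Rightarrow> 'k) \<Rightarrow> 'a \<Rightarrow> 'k" where
  "dual_lie f g a = g \<lbrace>a, R f\<rbrace> - f \<lbrace>a, R g\<rbrace>"

lemma functional_ops [simp]:
  assumes "functional f"
  shows "functional (\<lambda>x. f (a \<odot> x))" "functional (\<lambda>x. f (x \<odot> a))"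
    "functional (\<lambda>x. f (a \<star> x))" "functional (\<lambda>x. f (x \<star> a))"
    "functional (\<lambda>x. f \<lbrace>a, x\<rbrace>)" "functional (\<lambda>x. f \<lbrace>x, a\<rbrace>)"
  by (rule functional_mult [OF circ_bilinear assms] functional_mult [OF bilinear_star assms]
      functional_mult [OF lie_bilinear assms])+

lemma ev2_flip: "functional f \<Longrightarrow> functional g \<Longrightarrow> ev2 f g r = - ev2 g f r"
  using skew skew_symmetric_iff by blast

text \<open>
  By skew-symmetry either argument can be moved into \<open>R\<close>. The choice matters below: a functional
  that is composed with a multiplication is kept outside, so that \<open>R\<close> is never applied to
  such a composition.
\<close>

lemma ev2_R:
  assumes "functional f" "functional g"
  shows "ev2 f g r = g (R f)" "ev2 f g r = - f (R g)"
  using ev2_flip [OF assms] by (simp_all add: functional_sharp assms)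

lemma ev2_Delta [simp]:
  assumes "functional f" "functional g"
  shows "ev2 f g (Delta a) = dual_circ f g a"
  using assms by (simp add: Delta_r_def dual_circ_def ev2_R(2) [of "\<lambda>x. f (a \<odot> x)" g]
      ev2_R(1) [of f "\<lambda>x. g (a \<star> x)"])

lemma ev2_delta [simp]:
  assumes "functional f" "functional g"
  shows "ev2 f g (delta a) = dual_lie f g a"
  using assms by (simp add: delta_r_def dual_lie_def ev2_R(2) [of "\<lambda>x. f \<lbrace>a, x\<rbrace>" g]
      ev2_R(1) [of f "\<lambda>x. g \<lbrace>a, x\<rbrace>"])

lemma functional_dual [simp]:
  assumes "functional f" "functional g"
  shows "functional (dual_circ f g)" "functional (dual_lie f g)"
  by (rule functionalI;
      simp add: dual_circ_def dual_lie_def sym_prod_def circ_simps lie_simps functional_linear assms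
        right_diff_distrib distrib_left)+

text \<open>
  The three shapes of terms that occur in \<open>N(r)\<close> and \<open>C(r)\<close>: the product joins two second legs,
  a second and a first leg, or two first legs of the two copies of \<open>r\<close>. Each first leg inside a
  product costs one sign.
\<close>

lemma pairing_quadratic:
  assumes m: "bilinear_op scale m" and f: "functional f" and g: "functional g" and h: "functional h"
  shows "pairing (\<lambda>u. pairing (\<lambda>v. f (fst u) * g (fst v) * h (m (snd u) (snd v))) r) r
      = h (m (R f) (R g))"
    and "pairing (\<lambda>u. pairing (\<lambda>v. f (fst u) * g (m (snd u) (fst v)) * h (snd v)) r) r
      = - g (m (R f) (R h))"
    and "pairing (\<lambda>u. pairing (\<lambda>v. f (m (fst u) (fst v)) * g (snd u) * h (snd v)) r) r
      = f (m (R g) (R h))"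
proof -
  note M = functional_mult [OF m]
  have E: "pairing (\<lambda>v. p (fst v) * q (snd v)) r = ev2 p q r" for p q
    by (simp add: ev2_def split_def)
  have "pairing (\<lambda>v. f (fst u) * g (fst v) * h (m (snd u) (snd v))) r
      = f (fst u) * h (m (snd u) (R g))" for u
    using E [of g "\<lambda>y. h (m (snd u) y)"] ev2_R(1) [OF g M(1) [OF h]]
    by (simp add: mult.assoc pairing_fun_mult)
  then show "pairing (\<lambda>u. pairing (\<lambda>v. f (fst u) * g (fst v) * h (m (snd u) (snd v))) r) r
      = h (m (R f) (R g))"
    using E [of f "\<lambda>y. h (m y (R g))"] ev2_R(1) [OF f M(2) [OF h]] by simp
  have "pairing (\<lambda>v. f (fst u) * g (m (snd u) (fst v)) * h (snd v)) r
      = - 1 * (f (fst u) * g (m (snd u) (R h)))" for u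
    using E [of "\<lambda>x. g (m (snd u) x)" h] ev2_R(2) [OF M(1) [OF g] h]
    by (simp add: mult.assoc pairing_fun_mult)
  then show "pairing (\<lambda>u. pairing (\<lambda>v. f (fst u) * g (m (snd u) (fst v)) * h (snd v)) r) r
      = - g (m (R f) (R h))"
    using E [of f "\<lambda>y. g (m y (R h))"] ev2_R(1) [OF f M(2) [OF g]]
    by (simp only: pairing_fun_mult) simp
  have "pairing (\<lambda>v. f (m (fst u) (fst v)) * g (snd u) * h (snd v)) r
      = - 1 * (f (m (fst u) (R h)) * g (snd u))" for u
  proof -
    have "pairing (\<lambda>v. f (m (fst u) (fst v)) * g (snd u) * h (snd v)) r
        = pairing (\<lambda>v. g (snd u) * (f (m (fst u) (fst v)) * h (snd v))) r"
      by (simp add: mult_ac)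
    then show ?thesis
      using E [of "\<lambda>x. f (m (fst u) x)" h] ev2_R(2) [OF M(1) [OF f] h]
      by (simp add: pairing_fun_mult)
  qed
  then show "pairing (\<lambda>u. pairing (\<lambda>v. f (m (fst u) (fst v)) * g (snd u) * h (snd v)) r) r
      = f (m (R g) (R h))"
    using E [of "\<lambda>x. f (m x (R h))" g] ev2_R(2) [OF M(2) [OF f] g]
    by (simp only: pairing_fun_mult) simp
qed

lemma ev3_lin2: "ev3 f g h (lin2 F p q) = pairing (\<lambda>u. pairing (\<lambda>v. ev3 f g h (F u v)) q) p"
  by (simp add: lin2_def ev3_def pairing_lin)

lemma ev3_NN:
  assumes "functional f" "functional g" "functional h"
  shows "ev3 f g h (NN circ r) = h (R f \<odot> R g) - g (R f \<star> R h) + f (R h \<odot> R g)"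
proof -
  have swap: "f (fst u \<odot> fst v) * g (snd v) * h (snd u)
      = f (fst u \<odot> fst v) * h (snd u) * g (snd v)" for u v :: "'a \<times> 'a"
    by (simp add: mult_ac)
  show ?thesis
    using assms
    by (simp add: NN_def ev3_lin2 split_def pairing_fun_add swap
        pairing_quadratic [OF circ_bilinear] pairing_quadratic [OF bilinear_star])
qed

lemma ev3_CC:
  assumes "functional f" "functional g" "functional h"
  shows "ev3 f g h (CC lie r) = f \<lbrace>R g, R h\<rbrace> - g \<lbrace>R f, R h\<rbrace> + h \<lbrace>R f, R g\<rbrace>"
  using assms
  by (simp add: CC_def ev3_lin2 split_def pairing_fun_add pairing_quadratic [OF lie_bilinear])

text \<open>
  Tested on a functional \<open>h\<close>, this is \<open>N(r) = 0\<close> evaluated at \<open>h, g, f\<close>.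
\<close>

lemma R_dual_circ:
  assumes "functional f" "functional g"
  shows "R (dual_circ f g) = R f \<odot> R g"
proof (rule functionals_separate)
  fix h assume h: "functional h"
  have "ev3 h g f (NN circ r) = 0"
    using gdybe assms h by (simp add: GDYBE_def tensor3_eq_iff)
  then have *: "h (R f \<odot> R g) = g (R h \<star> R f) - f (R h \<odot> R g)"
    using assms h by (simp add: ev3_NN algebra_simps)
  have "h (R (dual_circ f g)) = - dual_circ f g (R h)"
    using ev2_R [OF h functional_dual(1) [OF assms]] by simp (metis minus_minus)
  then show "h (R (dual_circ f g)) = h (R f \<odot> R g)"
    by (simp add: * dual_circ_def)
qed

text \<open>
  Tested on a functional \<open>h\<close>, this is \<open>C(r) = 0\<close> evaluated at \<open>h, f, g\<close>.
\<close>

lemma R_dual_lie: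
  assumes "functional f" "functional g"
  shows "R (dual_lie f g) = \<lbrace>R f, R g\<rbrace>"
proof (rule functionals_separate)
  fix h assume h: "functional h"
  have "ev3 h f g (CC lie r) = 0"
    using gdybe assms h by (simp add: GDYBE_def tensor3_eq_iff)
  then have *: "h \<lbrace>R f, R g\<rbrace> = f \<lbrace>R h, R g\<rbrace> - g \<lbrace>R h, R f\<rbrace>"
    using assms h by (simp add: ev3_CC algebra_simps)
  have "h (R (dual_lie f g)) = - dual_lie f g (R h)"
    using ev2_R [OF h functional_dual(2) [OF assms]] by simp (metis minus_minus)
  then show "h (R (dual_lie f g)) = h \<lbrace>R f, R g\<rbrace>"
    by (simp add: * dual_lie_def)
qed

lemma dual_circ_circ:
  assumes "functional f" "functional g" "functional h"
  shows "dual_circ f (dual_circ g h) a = f (a \<odot> (R g \<odot> R h)) - g ((a \<star> R f) \<odot> R h) + h ((a \<star> R f) \<star> R g)"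
    and "dual_circ (dual_circ f g) h a = f ((a \<odot> R h) \<odot> R g) - g ((a \<odot> R h) \<star> R f) - h (a \<star> (R f \<odot> R g))"
  using assms by (simp_all add: dual_circ_def [of _ "dual_circ _ _"] dual_circ_def [of "dual_circ _ _"] R_dual_circ)
     (simp_all add: dual_circ_def)

lemma dual_lie_lie:
  assumes "functional f" "functional g" "functional h"
  shows "dual_lie f (dual_lie g h) a = h \<lbrace>\<lbrace>a, R f\<rbrace>, R g\<rbrace> - g \<lbrace>\<lbrace>a, R f\<rbrace>, R h\<rbrace> - f \<lbrace>a, \<lbrace>R g, R h\<rbrace>\<rbrace>"
    and "dual_lie (dual_lie f g) h a = h \<lbrace>a, \<lbrace>R f, R g\<rbrace>\<rbrace> - g \<lbrace>\<lbrace>a, R h\<rbrace>, R f\<rbrace> + f \<lbrace>\<lbrace>a, R h\<rbrace>, R g\<rbrace>"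
  using assms by (simp_all add: dual_lie_def [of _ "dual_lie _ _"] dual_lie_def [of "dual_lie _ _"] R_dual_lie)
     (simp_all add: dual_lie_def)

lemma dual_circ_lie:
  assumes "functional f" "functional g" "functional h"
  shows "dual_circ f (dual_lie g h) a = f (a \<odot> \<lbrace>R g, R h\<rbrace>) - h \<lbrace>a \<star> R f, R g\<rbrace> + g \<lbrace>a \<star> R f, R h\<rbrace>"
    and "dual_circ (dual_lie f g) h a = g \<lbrace>a \<odot> R h, R f\<rbrace> - f \<lbrace>a \<odot> R h, R g\<rbrace> - h (a \<star> \<lbrace>R f, R g\<rbrace>)"
    and "dual_lie f (dual_circ g h) a = g (\<lbrace>a, R f\<rbrace> \<odot> R h) - h (\<lbrace>a, R f\<rbrace> \<star> R g) - f \<lbrace>a, R g \<odot> R h\<rbrace>"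
    and "dual_lie (dual_circ f g) h a = h \<lbrace>a, R f \<odot> R g\<rbrace> - f (\<lbrace>a, R h\<rbrace> \<odot> R g) + g (\<lbrace>a, R h\<rbrace> \<star> R f)"
  using assms
  by (simp_all add: dual_circ_def [of _ "dual_lie _ _"] dual_circ_def [of "dual_lie _ _"]
        dual_lie_def [of _ "dual_circ _ _"] dual_lie_def [of "dual_circ _ _"] R_dual_lie R_dual_circ)
     (simp_all add: dual_lie_def dual_circ_def)


section \<open>Coalgebra axioms\<close>

lemma novikov_coalgebra_Delta: "novikov_coalgebra scale Delta"
proof unfold_locales
  show "colinear scale Delta"
    by (rule colinearI) simp
  show "id_tensor Delta (Delta a) - tau_id (id_tensor Delta (Delta a))
         \<approx>\<^sub>3 tensor_id Delta (Delta a) - tau_id (tensor_id Delta (Delta a))" for a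
    unfolding tensor3_eq_iff
  proof (intro allI impI)
    fix f g h assume F: "functional f" "functional g" "functional h"
    show "ev3 f g h (id_tensor Delta (Delta a) - tau_id (id_tensor Delta (Delta a))) =
      ev3 f g h (tensor_id Delta (Delta a) - tau_id (tensor_id Delta (Delta a)))"
      \<comment> \<open>The arguments of \<open>f\<close> and \<open>g\<close> agree by \<open>circ_circ\<close>, those of \<open>h\<close> by \<open>star_star\<close>.\<close>
      using F by (simp add: dual_circ_circ circ_circ [of a] star_star [of a "R f" "R g"] functional_linear)
  qed
  show "tau_id (id_tensor Delta (tau (Delta a))) \<approx>\<^sub>3 tensor_id Delta (Delta a)" for a
    unfolding tensor3_eq_iff
  proof (intro allI impI)
    fix f g h assume F: "functional f" "functional g" "functional h"
    show "ev3 f g h (tau_id (id_tensor Delta (tau (Delta a)))) = ev3 f g h (tensor_id Delta (Delta a))"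
      \<comment> \<open>The arguments of \<open>f\<close> agree by right commutativity, those of \<open>g\<close> and \<open>h\<close> by \<open>star_circ\<close>.\<close>
      using F by (simp add: dual_circ_circ star_circ right_commutative [of a "R g" "R h"])
  qed
qed

lemma lie_coalgebra_delta: "lie_coalgebra scale delta"
proof unfold_locales
  show "colinear scale delta"
    by (rule colinearI) simp
  show "delta a \<approx>\<^sub>2 - tau (delta a)" for a
    by (simp add: tensor2_eq_iff dual_lie_def)
  show "id_tensor delta (delta a) - tau_id (id_tensor delta (delta a)) \<approx>\<^sub>3 tensor_id delta (delta a)" for a
    unfolding tensor3_eq_iff
  proof (intro allI impI)
    fix f g h assume F: "functional f" "functional g" "functional h"
    show "ev3 f g h (id_tensor delta (delta a) - tau_id (id_tensor delta (delta a))) =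
      ev3 f g h (tensor_id delta (delta a))"
      using F by (simp add: dual_lie_lie lie_lie [of a] functional_linear)
  qed
qed

lemma gd_coalgebra_Delta_delta: "gd_coalgebra scale Delta delta"
proof (intro gd_coalgebra.intro gd_coalgebra_axioms.intro novikov_coalgebra_Delta lie_coalgebra_delta)
  fix a
  show "id_tensor delta (Delta a) - tau_id (id_tensor Delta (delta a)) + tau_id (id_tensor delta (tau (Delta a)))
       \<approx>\<^sub>3 tensor_id Delta (delta a) + tensor_id delta (Delta a)"
    unfolding tensor3_eq_iff
  proof (intro allI impI)
    fix f g h assume F: "functional f" "functional g" "functional h"
    show "ev3 f g h (id_tensor delta (Delta a) - tau_id (id_tensor Delta (delta a))
          + tau_id (id_tensor delta (tau (Delta a)))) =
        ev3 f g h (tensor_id Delta (delta a) + tensor_id delta (Delta a))"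
      \<comment> \<open>The arguments of \<open>f\<close> agree by \<open>circ_lie\<close>, those of \<open>g\<close> and \<open>h\<close> by \<open>lie_circ\<close>.\<close>
      using F by (simp add: dual_circ_lie circ_lie [of a] lie_circ [of a] functional_linear)
  qed
qed


section \<open>Compatibility of products and coproducts\<close>

text \<open>
  The compatibility conditions are matched leg by leg as sums over \<open>r\<close>, so here \<open>\<Delta>\<^sub>r\<close> and \<open>\<delta>\<^sub>r\<close> are
  expanded into evaluations of \<open>r\<close> rather than into the dual operations.
\<close>

lemma ev2_Delta_r:
  "ev2 f g (Delta a) = - (ev2 (\<lambda>x. f (a \<odot> x)) g r + ev2 f (\<lambda>x. g (a \<star> x)) r)"
  by (simp add: Delta_r_def)

lemma ev2_delta_r:
  "ev2 f g (delta a) = ev2 (\<lambda>x. f \<lbrace>a, x\<rbrace>) g r + ev2 f (\<lambda>x. g \<lbrace>a, x\<rbrace>) r"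
  by (simp add: delta_r_def)

text \<open>
  By skew-symmetry \<open>\<tau> \<Delta>\<^sub>r(a) = (L\<^sub>\<star>(a) \<otimes> id + id \<otimes> L\<^sub>\<circ>(a)) r\<close>, and \<open>L\<^sub>\<star> - L\<^sub>\<circ> = R\<^sub>\<circ>\<close>.
\<close>

lemma ev2_Delta_symmetrized:
  assumes "functional f" "functional g"
  shows "ev2 f g (Delta a + tau (Delta a)) = ev2 (\<lambda>x. f (x \<odot> a)) g r - ev2 f (\<lambda>x. g (x \<odot> a)) r"
proof -
  have "ev2 (\<lambda>x. g (a \<odot> x)) f r = - ev2 f (\<lambda>x. g (a \<odot> x)) r"
    "ev2 g (\<lambda>x. f (a \<star> x)) r = - ev2 (\<lambda>x. f (a \<star> x)) g r"
    using assms by (intro ev2_flip; simp)+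
  moreover have "(\<lambda>x. f (a \<star> x)) = (\<lambda>x. f (a \<odot> x) + f (x \<odot> a))"
     "(\<lambda>x. g (a \<star> x)) = (\<lambda>x. g (a \<odot> x) + g (x \<odot> a))"
    using assms by (simp_all add: sym_prod_def functional_linear)
  ultimately show ?thesis
    by (simp add: ev2_Delta_r ev2_fun_add del: ev2_Delta)
qed

lemma novikov_bialgebra_Delta: "novikov_bialgebra scale circ Delta"
proof (intro novikov_bialgebra.intro novikov_bialgebra_axioms.intro novikov_coalgebra_Delta novikov_algebra_axioms)
  fix a b
  show "Delta (a \<odot> b) \<approx>\<^sub>2 tensor_map (\<lambda>x. x \<odot> b) id (Delta a)
         + tensor_map id (sym_prod circ a) (Delta b + tau (Delta b))"
    unfolding tensor2_eq_iff
  proof (intro allI impI)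
    fix f g assume F: "functional f" "functional g"
    show "ev2 f g (Delta (a \<odot> b)) = ev2 f g (tensor_map (\<lambda>x. x \<odot> b) id (Delta a)
         + tensor_map id (sym_prod circ a) (Delta b + tau (Delta b)))"
      using F
      by (subst ev2_simps(1)) (simp add: ev2_Delta_symmetrized ev2_Delta_r star_circ
          right_commutative [of a _ b] del: ev2_Delta ev2_simps(1))
  qed
  show "tensor_map (sym_prod circ a) id (Delta b) - tensor_map id (sym_prod circ a) (tau (Delta b))
         \<approx>\<^sub>2 tensor_map (sym_prod circ b) id (Delta a) - tensor_map id (sym_prod circ b) (tau (Delta a))"
    unfolding tensor2_eq_iff
  proof (intro allI impI)
    fix f g assume F: "functional f" "functional g"
    have "a \<star> (b \<odot> x) = b \<star> (a \<odot> x)" for x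
      by (simp add: star_circ sym_prod_commute [of _ b])
    then show "ev2 f g (tensor_map (sym_prod circ a) id (Delta b) - tensor_map id (sym_prod circ a) (tau (Delta b))) =
        ev2 f g (tensor_map (sym_prod circ b) id (Delta a) - tensor_map id (sym_prod circ b) (tau (Delta a)))"
      using F ev2_flip [of f "\<lambda>x. g (a \<star> (b \<odot> x))"] ev2_flip [of "\<lambda>x. f (a \<star> x)" "\<lambda>x. g (b \<star> x)"]
        ev2_flip [of "\<lambda>x. f (b \<star> x)" "\<lambda>x. g (a \<star> x)"]
      by (simp add: ev2_Delta_r del: ev2_Delta)
  qed
  show "tensor_map id (\<lambda>x. x \<odot> a) (Delta b + tau (Delta b)) - tensor_map (\<lambda>x. x \<odot> a) id (Delta b + tau (Delta b))
         \<approx>\<^sub>2 tensor_map id (\<lambda>x. x \<odot> b) (Delta a + tau (Delta a)) - tensor_map (\<lambda>x. x \<odot> b) id (Delta a + tau (Delta a))"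
    unfolding tensor2_eq_iff
  proof (intro allI impI)
    fix f g assume F: "functional f" "functional g"
    show "ev2 f g (tensor_map id (\<lambda>x. x \<odot> a) (Delta b + tau (Delta b)) - tensor_map (\<lambda>x. x \<odot> a) id (Delta b + tau (Delta b))) =
        ev2 f g (tensor_map id (\<lambda>x. x \<odot> b) (Delta a + tau (Delta a)) - tensor_map (\<lambda>x. x \<odot> b) id (Delta a + tau (Delta a)))"
      using F
      by (simp add: ev2_Delta_symmetrized right_commutative [of _ b a] del: ev2_simps(1))
  qed
qed

lemma lie_bialgebra_delta: "lie_bialgebra scale lie delta"
proof (intro lie_bialgebra.intro lie_bialgebra_axioms.intro lie_coalgebra_delta lie_algebra_axioms)
  fix a b
  have jac: "\<lbrace>\<lbrace>a, b\<rbrace>, x\<rbrace> = \<lbrace>a, \<lbrace>b, x\<rbrace>\<rbrace> - \<lbrace>b, \<lbrace>a, x\<rbrace>\<rbrace>" for x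
    by (simp add: lie_lie [of a b x] lie_anti [of b "\<lbrace>a, x\<rbrace>"])
  show "delta \<lbrace>a, b\<rbrace> \<approx>\<^sub>2 lie_act lie a (delta b) - lie_act lie b (delta a)"
    unfolding tensor2_eq_iff
  proof (intro allI impI)
    fix f g assume F: "functional f" "functional g"
    show "ev2 f g (delta \<lbrace>a, b\<rbrace>) = ev2 f g (lie_act lie a (delta b) - lie_act lie b (delta a))"
      using F by (simp add: ev2_delta_r jac functional_linear ev2_fun_linear del: ev2_delta)
  qed
qed

lemma gd_bialgebra_Delta_delta: "gd_bialgebra scale circ lie Delta delta"
proof (intro gd_bialgebra.intro gd_bialgebra_axioms.intro gd_algebra_axioms gd_coalgebra_Delta_delta
    novikov_bialgebra_Delta lie_bialgebra_delta)
  fix a b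
  \<comment> \<open>The condition on the terms that act on the first leg of \<open>r\<close>, and below on the second leg;
    terms that act on both legs cancel.\<close>
  have K1: "\<lbrace>b \<odot> a, x\<rbrace> = b \<odot> \<lbrace>a, x\<rbrace> - \<lbrace>a, b \<odot> x\<rbrace> + \<lbrace>b, x\<rbrace> \<odot> a + \<lbrace>a, b\<rbrace> \<odot> x" for x
    by (simp add: circ_lie [of b a x] lie_anti [of a "b \<odot> x"] lie_anti [of a b] circ_simps)
  have K2: "\<lbrace>b, x \<odot> a\<rbrace> = \<lbrace>b \<odot> a, x\<rbrace> - \<lbrace>a, b\<rbrace> \<star> x - b \<star> \<lbrace>a, x\<rbrace> + \<lbrace>a, b \<star> x\<rbrace>" for x
    by (simp add: lie_circ [of b x a] lie_anti [of x a] lie_anti [of b a] lie_anti [of "b \<star> x" a]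
        bilinear_op_simps [OF bilinear_star])
  show "delta (b \<odot> a) + Delta \<lbrace>a, b\<rbrace> \<approx>\<^sub>2
       tensor_map (\<lambda>x. x \<odot> a) id (delta b) + tensor_map (\<lambda>x. b \<odot> x) id (delta a)
       + tensor_map id (sym_prod circ b) (delta a) + lie_act lie a (Delta b)
       - tensor_map id (lie b) (Delta a + tau (Delta a))" (is "?l \<approx>\<^sub>2 ?r")
    unfolding tensor2_eq_iff
  proof (intro allI impI)
    fix f g assume F: "functional f" "functional g"
    have 1: "ev2 (\<lambda>x. f \<lbrace>b \<odot> a, x\<rbrace>) g r = ev2 (\<lambda>x. f (b \<odot> \<lbrace>a, x\<rbrace>)) g r - ev2 (\<lambda>x. f \<lbrace>a, b \<odot> x\<rbrace>) g r
        + ev2 (\<lambda>x. f (\<lbrace>b, x\<rbrace> \<odot> a)) g r + ev2 (\<lambda>x. f (\<lbrace>a, b\<rbrace> \<odot> x)) g r"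
      using F by (simp add: K1 functional_linear ev2_fun_linear)
    have 2: "ev2 f (\<lambda>x. g \<lbrace>b, x \<odot> a\<rbrace>) r = ev2 f (\<lambda>x. g \<lbrace>b \<odot> a, x\<rbrace>) r - ev2 f (\<lambda>x. g (\<lbrace>a, b\<rbrace> \<star> x)) r
        - ev2 f (\<lambda>x. g (b \<star> \<lbrace>a, x\<rbrace>)) r + ev2 f (\<lambda>x. g \<lbrace>a, b \<star> x\<rbrace>) r"
      using F by (simp add: K2 functional_linear ev2_fun_linear)
    have 3: "ev2 f g (tensor_map id (lie b) (Delta a + tau (Delta a)))
       = ev2 (\<lambda>x. f (x \<odot> a)) (\<lambda>x. g \<lbrace>b, x\<rbrace>) r - ev2 f (\<lambda>x. g \<lbrace>b, x \<odot> a\<rbrace>) r"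
      using F by (simp add: ev2_Delta_symmetrized del: ev2_simps(1))
    show "ev2 f g ?l = ev2 f g ?r"
      unfolding ev2_simps(1,2) 3 2
      by (simp add: 1 ev2_Delta_r ev2_delta_r del: ev2_Delta ev2_delta)
  qed
qed

end

theorem proposition3p5:
  fixes scale :: "'k::field_char_0 \<Rightarrow> 'a::ab_group_add \<Rightarrow> 'a"
    and circ lie :: "'a \<Rightarrow> 'a \<Rightarrow> 'a"
    and r :: "'a \<times> 'a \<Rightarrow>\<^sub>0 'k"
  assumes "gd_algebra scale circ lie"
    and "skew_symmetric scale r"
    and "GDYBE scale circ lie r"
  shows "gd_bialgebra scale circ lie (Delta_r circ r) (delta_r lie r)"
proof -
  interpret skew_gdybe_solution scale circ lie r
    using assms by (intro skew_gdybe_solution.intro skew_gdybe_solution_axioms.intro)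
  show ?thesis by (rule gd_bialgebra_Delta_delta)
qed

end
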